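(* Let $N_{\rm sc}$ be even and let RO-QPSK symbols be transmitted with i.i.d. I/Q components $\{\alpha_m\}_{m=0}^{N_{\rm sc}-1}$. Then, for every $l\in\{0,\dots,N_{\rm sc}/2-1\}$, the effective SINR of the post-combined received symbol $\tilde r[l]=\mu_{w,G}q_l+\mathcal{I}_l+\tilde n_l$, namely $\mathsf{SINR}^{\rm RO-QPSK}=\mu_{w,G}^2/\left(\mathbb{E}[|\mathcal{I}_l|^2]+\mathbb{E}[|\tilde n_l|^2]\right)$, equals $$\mathsf{SINR}^{\rm RO-QPSK}=\frac{\mu_{w,G}^2}{\varrho_{w,G}^2+\frac12\mu_{w,|E|^2}},$$ where $$\mu_{w,G}=\frac{1}{N_{\rm sc}}\sum_{k=0}^{N_{\rm sc}-1}w_kG_k,$$ the noise power is given through $$\mu_{w,|E|^2}=\frac{1}{N_{\rm sc}}\sum_{k=0}^{N_{\rm sc}-1}w_k|E_k|^2,\qquad \mathbb{E}[|\tilde n_l|^2]=\tfrac12\mu_{w,|E|^2},$$ and the interference power is $\mathbb{E}[|\mathcal{I}_l|^2]=\varrho^2_{w,G}=\nu_{w,G}-\mu_{w,G}^2$ with $$\nu_{w,G}=\frac{1}{2N_{\rm sc}}\sum_{k=0}^{N_{\rm sc}-1}w_kG_k\left(w_kG_k+(2-w_k)G_{\frac{N_{\rm sc}}{2}-k}\right)\approx\frac{1}{N_{\rm sc}}\sum_{k=0}^{N_{\rm sc}-1}w_kG_k^2,$$ the indices of $G$ being taken modulo $N_{\rm sc}$; and therefore $\varrho^2_{w,G}\approx\sigma^2_{w,G}$,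 where $\sigma^2_{w,G}=\frac{1}{N_{\rm sc}}\sum_{k=0}^{N_{\rm sc}-1}w_kG_k^2-\mu_{w,G}^2$ is the Hann-weighted variance of the gains $G_k$.
   Context: Let ${\rm j}=\sqrt{-1}$ and let $w_k=1-\cos\frac{2\pi k}{N_{\rm sc}}$ be the Hann weights. Bits $b_0,\dots,b_{N_{\rm sc}-1}\in\{0,1\}$ are i.i.d. equiprobable and $\alpha_m=\frac{1}{\sqrt2}(1-2b_m)$, with indices of $\alpha$ taken modulo $N_{\rm sc}$ (so $\alpha_{-1}=\alpha_{N_{\rm sc}-1}$). RO-QPSK (repeated-and-offset QPSK): for $N_{\rm sc}$ even, the transmitted symbols are, for $0\le m\le N_{\rm sc}-1$, $x[m]=\alpha_m-{\rm j}\alpha_{m-1}$ if $m$ is even and $x[m]=-\alpha_{m-1}+{\rm j}\alpha_m$ if $m$ is odd. Transmission and equalization: $X_k=\frac{1}{\sqrt{N_{\rm sc}}}\sum_{m=0}^{N_{\rm sc}-1}x[m]e^{-{\rm j}\frac{2\pi}{N_{\rm sc}}km}$; $Y_k=\widetilde H_kX_k+Z_k$, where $\widetilde H_k\in\mathbb{C}$ are fixed (deterministic) effective channel coefficients and $Z_0,\dots,Z_{N_{\rm sc}-1}$ are i.i.d. circularly symmetric complex Gaussian with zero mean and $\mathbb{E}[|Z_k|^2]=1$, independent of the data; $\widetilde Y_k=E_kY_k$ with deterministic single-tap equalizer coefficients $E_k\in\mathbb{C}$ such that $G_k=E_k\widetilde H_k$ is real for every $k$ (index of $G$ extended modulo $N_{\rm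 sc}$). After DFT de-spreading, $r[m]=\frac{1}{\sqrt{N_{\rm sc}}}\sum_{k=0}^{N_{\rm sc}-1}\widetilde Y_ke^{{\rm j}\frac{2\pi}{N_{\rm sc}}km}$ with noise component $n[m]=\frac{1}{\sqrt{N_{\rm sc}}}\sum_{k=0}^{N_{\rm sc}-1}E_kZ_ke^{{\rm j}\frac{2\pi}{N_{\rm sc}}km}$, indices $m$ taken modulo $N_{\rm sc}$. Combining: for $0\le l\le N_{\rm sc}/2-1$, $$\tilde r[l]=\Re\left\{\tfrac{r[2l]-r[2l+1]}{2}\right\}+{\rm j}\,\Im\left\{\tfrac{r[2l+1]-r[2l+2]}{2}\right\},\qquad \tilde n_l=\Re\left\{\tfrac{n[2l]-n[2l+1]}{2}\right\}+{\rm j}\,\Im\left\{\tfrac{n[2l+1]-n[2l+2]}{2}\right\}.$$ The equivalent QPSK symbols are $q_l=\alpha_{2l}+{\rm j}\alpha_{2l+1}$, and the interference term is $\mathcal{I}_l=\tilde r[l]-\mu_{w,G}q_l-\tilde n_l$. Expectations are over data and noise. The sign $\approx$ is used informally, without an error bound: it denotes the result of the approximation $G_{\frac{N_{\rm sc}}{2}-k}\approx G_k$ in the formula for $\nu_{w,G}$, motivated by these two gains being at nearby indices when $k$ is close to $\frac{N_{\rm sc}}{4}$ or $\frac{3N_{\rm sc}}{4}$. All other equalities are exact. *)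

theory Defs
  imports "HOL-Probability.Probability"
begin

definition wrap :: "nat \<Rightarrow> (nat \<Rightarrow> 'b) \<Rightarrow> int \<Rightarrow> 'b" where
  "wrap N f i = f (nat (i mod int N))"

definition hann :: "nat \<Rightarrow> nat \<Rightarrow> real" where
  "hann N k = 1 - cos (2 * pi * real k / real N)"

definition hann_mean :: "nat \<Rightarrow> (nat \<Rightarrow> real) \<Rightarrow> real" where
  "hann_mean N f = (1 / real N) * (\<Sum>k<N. hann N k * f k)"

definition dft :: "nat \<Rightarrow> (nat \<Rightarrow> complex) \<Rightarrow> nat \<Rightarrow> complex" where
  "dft N x k = of_real (1 / sqrt (real N)) *
     (\<Sum>m<N. x m * exp (- \<i> * of_real (2 * pi / real N * real k * real m)))"

definition idft :: "nat \<Rightarrow> (nat \<Rightarrow> complex) \<Rightarrow> nat \<Rightarrow> complex" where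
  "idft N Y m = of_real (1 / sqrt (real N)) *
     (\<Sum>k<N. Y k * exp (\<i> * of_real (2 * pi / real N * real k * real m)))"

text \<open>A bit is a truth value, \<open>True\<close> standing for 1 and \<open>False\<close> for 0.\<close>

definition pam :: "bool \<Rightarrow> real" where
  "pam c = (1 / sqrt 2) * (1 - 2 * of_bool c)"

text \<open>In the deterministic part of the model \<open>a\<close> is a realisation of the I/Q components,
  \<open>z\<close> of the frequency-domain noise, \<open>H\<close> the channel and \<open>E\<close> the equalizer.\<close>

definition ro_qpsk :: "nat \<Rightarrow> (nat \<Rightarrow> real) \<Rightarrow> nat \<Rightarrow> complex" where
  "ro_qpsk N a m =
     (if even m then of_real (a m) - \<i> * of_real (wrap N a (int m - 1))
      else - of_real (wrap N a (int m - 1)) + \<i> * of_real (a m))"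

definition received ::
  "nat \<Rightarrow> (nat \<Rightarrow> complex) \<Rightarrow> (nat \<Rightarrow> real) \<Rightarrow> (nat \<Rightarrow> complex) \<Rightarrow> nat \<Rightarrow> complex" where
  "received N H a z k = H k * dft N (ro_qpsk N a) k + z k"

definition despread :: "nat \<Rightarrow> (nat \<Rightarrow> complex) \<Rightarrow> (nat \<Rightarrow> complex) \<Rightarrow> (nat \<Rightarrow> real) \<Rightarrow>
    (nat \<Rightarrow> complex) \<Rightarrow> nat \<Rightarrow> complex" where
  "despread N H E a z = idft N (\<lambda>k. E k * received N H a z k)"

definition despread_noise ::
  "nat \<Rightarrow> (nat \<Rightarrow> complex) \<Rightarrow> (nat \<Rightarrow> complex) \<Rightarrow> nat \<Rightarrow> complex" where
  "despread_noise N E z = idft N (\<lambda>k. E k * z k)"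

definition combine :: "nat \<Rightarrow> (nat \<Rightarrow> complex) \<Rightarrow> nat \<Rightarrow> complex" where
  "combine N r l =
     of_real (Re ((r (2 * l) - r (2 * l + 1)) / 2)) +
     \<i> * of_real (Im ((r (2 * l + 1) - wrap N r (int (2 * l + 2))) / 2))"

definition qpsk :: "(nat \<Rightarrow> real) \<Rightarrow> nat \<Rightarrow> complex" where
  "qpsk a l = of_real (a (2 * l)) + \<i> * of_real (a (2 * l + 1))"

text \<open>\<open>Re\<close> only serves to give the gain the type \<open>real\<close>: the products \<open>E k * H k\<close> are real in
  the system considered.\<close>

definition gain :: "(nat \<Rightarrow> complex) \<Rightarrow> (nat \<Rightarrow> complex) \<Rightarrow> nat \<Rightarrow> real" where
  "gain H E k = Re (E k * H k)"

definition interference :: "nat \<Rightarrow> (nat \<Rightarrow> complex) \<Rightarrow> (nat \<Rightarrow> complex) \<Rightarrow> (nat \<Rightarrow> real) \<Rightarrow>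
    (nat \<Rightarrow> complex) \<Rightarrow> nat \<Rightarrow> complex" where
  "interference N H E a z l =
     combine N (despread N H E a z) l
     - of_real (hann_mean N (gain H E)) * qpsk a l
     - combine N (despread_noise N E z) l"

text \<open>The second gain sequence \<open>G'\<close> takes the place of the reflected gains, so that replacing
  the reflected gains by \<open>G\<close> itself is the application \<open>nu_with N G G\<close>.\<close>

definition nu_with :: "nat \<Rightarrow> (nat \<Rightarrow> real) \<Rightarrow> (nat \<Rightarrow> real) \<Rightarrow> real" where
  "nu_with N G G' =
     (1 / (2 * real N)) * (\<Sum>k<N. hann N k * G k * (hann N k * G k + (2 - hann N k) * G' k))"

definition nu :: "nat \<Rightarrow> (nat \<Rightarrow> real) \<Rightarrow> real" where
  "nu N G = nu_with N G (\<lambda>k. wrap N G (int (N div 2) - int k))"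

definition rho_sq :: "nat \<Rightarrow> (nat \<Rightarrow> real) \<Rightarrow> real" where
  "rho_sq N G = nu N G - (hann_mean N G)\<^sup>2"

definition sigma_sq :: "nat \<Rightarrow> (nat \<Rightarrow> real) \<Rightarrow> real" where
  "sigma_sq N G = (1 / real N) * (\<Sum>k<N. hann N k * (G k)\<^sup>2) - (hann_mean N G)\<^sup>2"

text \<open>Circularly symmetric complex Gaussian with mean zero and \<open>\<bbbE>|Z|\<^sup>2 = v\<close>.\<close>

definition circ_gaussian :: "'a measure \<Rightarrow> real \<Rightarrow> ('a \<Rightarrow> complex) \<Rightarrow> bool" where
  "circ_gaussian M v Z \<longleftrightarrow>
     distributed M lborel (\<lambda>\<omega>. Re (Z \<omega>)) (normal_density 0 (sqrt (v / 2))) \<and>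
     distributed M lborel (\<lambda>\<omega>. Im (Z \<omega>)) (normal_density 0 (sqrt (v / 2))) \<and>
     prob_space.indep_var M borel (\<lambda>\<omega>. Re (Z \<omega>)) borel (\<lambda>\<omega>. Im (Z \<omega>))"

lemma circ_gaussian_moments:
  assumes "prob_space M" and v: "v > 0" and Z: "circ_gaussian M v Z"
  shows "has_bochner_integral M Z 0"
    and "has_bochner_integral M (\<lambda>\<omega>. (cmod (Z \<omega>))\<^sup>2) v"
proof -
  interpret prob_space M by fact
  have s: "0 < sqrt (v / 2)" using v by simp
  have dR: "distributed M lborel (\<lambda>\<omega>. Re (Z \<omega>)) (normal_density 0 (sqrt (v / 2)))"
    and dI: "distributed M lborel (\<lambda>\<omega>. Im (Z \<omega>)) (normal_density 0 (sqrt (v / 2)))"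
    using Z unfolding circ_gaussian_def by auto
  have first: "has_bochner_integral M X 0"
    and second: "has_bochner_integral M (\<lambda>\<omega>. (X \<omega>)\<^sup>2) (v / 2)"
    if d: "distributed M lborel X (normal_density 0 (sqrt (v / 2)))" for X :: "'a \<Rightarrow> real"
  proof -
    have 1: "integrable lborel (\<lambda>x. normal_density 0 (sqrt (v/2)) x * x)"
      using integrable_normal_moment[OF s, of 0 1] by simp
    have 2: "integrable lborel (\<lambda>x. normal_density 0 (sqrt (v/2)) x * x\<^sup>2)"
      using integrable_normal_moment[OF s, of 0 2] by simp
    have "integrable M X"
      using 1 distributed_integrable[OF d, of "\<lambda>x. x"] by simp
    then show "has_bochner_integral M X 0"
      using normal_distributed_expectation[OF s d]
      by (simp add: has_bochner_integral_iff)
    have "integrable M (\<lambda>\<omega>. (X \<omega>)\<^sup>2)"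
      using 2 distributed_integrable[OF d, of "\<lambda>x. x\<^sup>2"] by simp
    then show "has_bochner_integral M (\<lambda>\<omega>. (X \<omega>)\<^sup>2) (v / 2)"
      using normal_distributed_variance[OF s d] normal_distributed_expectation[OF s d] v
      by (simp add: has_bochner_integral_iff)
  qed
  have "has_bochner_integral M (\<lambda>\<omega>. of_real (Re (Z \<omega>)) + \<i> * of_real (Im (Z \<omega>)) :: complex)
      (of_real 0 + \<i> * of_real 0)"
    by (intro has_bochner_integral_add has_bochner_integral_mult_right
        has_bochner_integral_of_real first dR dI)
  then show "has_bochner_integral M Z 0"
    by (simp add: complex_eq[symmetric])
  have "has_bochner_integral M (\<lambda>\<omega>. (Re (Z \<omega>))\<^sup>2 + (Im (Z \<omega>))\<^sup>2) (v / 2 + v / 2)"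
    by (intro has_bochner_integral_add second dR dI)
  then show "has_bochner_integral M (\<lambda>\<omega>. (cmod (Z \<omega>))\<^sup>2) v"
    by (simp add: cmod_power2)
qed

text \<open>\<open>prob_space.indep_var\<close> requires the two variables to have the same type, hence this version.\<close>

definition indep_pair ::
  "'a measure \<Rightarrow> 'b measure \<Rightarrow> ('a \<Rightarrow> 'b) \<Rightarrow> 'c measure \<Rightarrow> ('a \<Rightarrow> 'c) \<Rightarrow> bool" where
  "indep_pair M S X T Y \<longleftrightarrow>
     X \<in> measurable M S \<and> Y \<in> measurable M T \<and>
     prob_space.indep_set M
       {X -` A \<inter> space M | A. A \<in> sets S} {Y -` B \<inter> space M | B. B \<in> sets T}"

text \<open>Only \<open>b m\<close> and \<open>Z k\<close> with \<open>m, k < N\<close> are part of the system.\<close>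

definition component :: "(nat \<Rightarrow> 'a \<Rightarrow> bool) \<Rightarrow> 'a \<Rightarrow> nat \<Rightarrow> real" where
  "component b \<omega> m = pam (b m \<omega>)"

definition interf_rv :: "nat \<Rightarrow> (nat \<Rightarrow> complex) \<Rightarrow> (nat \<Rightarrow> complex) \<Rightarrow> (nat \<Rightarrow> 'a \<Rightarrow> bool) \<Rightarrow>
    (nat \<Rightarrow> 'a \<Rightarrow> complex) \<Rightarrow> nat \<Rightarrow> 'a \<Rightarrow> complex" where
  "interf_rv N H E b Z l \<omega> = interference N H E (component b \<omega>) (\<lambda>k. Z k \<omega>) l"

definition noise_rv ::
  "nat \<Rightarrow> (nat \<Rightarrow> complex) \<Rightarrow> (nat \<Rightarrow> 'a \<Rightarrow> complex) \<Rightarrow> nat \<Rightarrow> 'a \<Rightarrow> complex" where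
  "noise_rv N E Z l \<omega> = combine N (despread_noise N E (\<lambda>k. Z k \<omega>)) l"

definition sinr :: "'a measure \<Rightarrow> nat \<Rightarrow> (nat \<Rightarrow> complex) \<Rightarrow> (nat \<Rightarrow> complex) \<Rightarrow>
    (nat \<Rightarrow> 'a \<Rightarrow> bool) \<Rightarrow> (nat \<Rightarrow> 'a \<Rightarrow> complex) \<Rightarrow> nat \<Rightarrow> real" where
  "sinr M N H E b Z l =
     (hann_mean N (gain H E))\<^sup>2 /
       ((\<integral>\<omega>. (cmod (interf_rv N H E b Z l \<omega>))\<^sup>2 \<partial>M) +
        (\<integral>\<omega>. (cmod (noise_rv N E Z l \<omega>))\<^sup>2 \<partial>M))"

end

theory Submission
  imports Defs
begin

text \<open>The transmitted sequence is the first difference \<open>x[m] = u[m] - u[m - 1]\<close> of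
  \<open>u[n] = \<alpha>\<^sub>n\<close> (\<open>n\<close> even) and \<open>u[n] = \<i> \<alpha>\<^sub>n\<close> (\<open>n\<close> odd), and the receiver takes differences
  once more. The two factors \<open>1 - \<zeta>\<^sup>k\<close> and \<open>1 - \<zeta>\<^sup>-\<^sup>k\<close> multiply to \<open>2 w\<^sub>k\<close>, so the half-difference
  of the despread signal is the circular convolution of \<open>u\<close> with the inverse Fourier transform
  \<open>h\<close> of \<open>w G\<close>, and \<open>h(0)\<close> is the Hann mean of \<open>G\<close>. Taking real or imaginary parts selects
  \<open>Re h(d)\<close> at even and \<open>Im h(d)\<close> at odd offsets \<open>d\<close>. As \<open>(Re h)\<^sup>2\<close> and \<open>(Im h)\<^sup>2\<close> are
  \<open>(|h|\<^sup>2 \<plusminus> Re (h\<^sup>2)) / 2\<close>, their sum over \<open>d\<close> is computed by Parseval; the alternating sum of \<open>h\<^sup>2\<close>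
  produces the reflection \<open>k \<mapsto> N/2 - k\<close>, under which \<open>w\<close> becomes \<open>2 - w\<close>. The noise power follows
  from \<open>|1 - \<zeta>\<^sup>k|\<^sup>2 = 2 w\<^sub>k\<close>.\<close>

section \<open>Sums of periodic functions over one period\<close>

lemma sum_periodic_reflect:
  fixes F :: "int \<Rightarrow> 'b::comm_monoid_add"
  assumes "N > 0" and F: "\<And>i. F (i mod int N) = F i"
  shows "(\<Sum>n<N. F (t - int n)) = (\<Sum>n<N. F (int n))"
\<comment> \<open>Reflection modulo \<open>N\<close> is an involution, so the same map is the
  witness in both directions.\<close>
proof (rule sum.reindex_bij_witness[where i = "\<lambda>n. nat ((t - int n) mod int N)"
      and j = "\<lambda>n. nat ((t - int n) mod int N)"])
  fix n assume "n \<in> {..<N}"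
  with assms(1) show "nat ((t - int (nat ((t - int n) mod int N))) mod int N) = n"
    "nat ((t - int (nat ((t - int n) mod int N))) mod int N) = n"
    "nat ((t - int n) mod int N) \<in> {..<N}" "nat ((t - int n) mod int N) \<in> {..<N}"
    by (auto simp: mod_simps nat_less_iff)
  show "F (int (nat ((t - int n) mod int N))) = F (t - int n)"
    using assms(1) by (simp add: F)
qed

text \<open>A shift is a composite of two reflections.\<close>

lemma sum_periodic_shift:
  fixes F :: "int \<Rightarrow> 'b::comm_monoid_add"
  assumes "N > 0" and F: "\<And>i. F (i mod int N) = F i"
  shows "(\<Sum>n<N. F (int n + t)) = (\<Sum>n<N. F (int n))"
proof -
  have "F (t - i mod int N) = F (t - i)" for i
    using F[of "t - i mod int N"] F[of "t - i"] by (simp add: mod_simps)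
  from sum_periodic_reflect[of N "\<lambda>i. F (t - i)" 0, OF assms(1) this]
  have "(\<Sum>n<N. F (int n + t)) = (\<Sum>n<N. F (t - int n))"
    by (simp add: add.commute)
  then show ?thesis using sum_periodic_reflect[of N F t] assms by simp
qed

section \<open>Roots of unity, orthogonality and Parseval's identity\<close>

text \<open>The exponent is an integer, so that conjugates and differences of time indices avoid
  truncated subtraction.\<close>

definition zeta :: "nat \<Rightarrow> int \<Rightarrow> complex" where
  "zeta N j = cis (2 * pi * of_int j / real N)"

lemma zeta_0 [simp]: "zeta N 0 = 1"
  by (simp add: zeta_def)

lemma zeta_add: "zeta N (i + j) = zeta N i * zeta N j"
  by (simp add: zeta_def cis_mult ring_distribs add_divide_distrib)

lemma cnj_zeta: "cnj (zeta N j) = zeta N (- j)"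
  by (simp add: zeta_def cis_cnj)

lemma cmod_zeta [simp]: "cmod (zeta N j) = 1"
  by (simp add: zeta_def)

lemma zeta_multiple [simp]: "zeta N (int N * j) = 1"
proof (cases "N = 0")
  case False
  then show ?thesis
    using cis_multiple_2pi[of "of_int j"] by (simp add: zeta_def mult.assoc)
qed simp

lemma zeta_cong:
  assumes "i mod int N = j mod int N"
  shows "zeta N i = zeta N j"
proof -
  from assms obtain t where "i = j + int N * t"
    by (metis mod_eqE)
  then show ?thesis by (simp add: zeta_add)
qed

lemma zeta_power: "zeta N (j * int d) = zeta N j ^ d"
  by (induction d) (simp_all add: zeta_add ring_distribs)

lemma zeta_eq_1_iff:
  assumes "N > 0"
  shows "zeta N j = 1 \<longleftrightarrow> int N dvd j"
proof
  assume "zeta N j = 1"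
  then have "cos (2 * pi * of_int j / real N) = 1"
    by (simp add: zeta_def complex_eq_iff)
  then obtain n :: int where "2 * pi * of_int j / real N = of_int n * 2 * pi"
    by (auto simp: cos_one_2pi_int)
  then have "real_of_int j = of_int (n * int N)"
    using assms by (simp add: field_simps)
  then have "j = n * int N" by linarith
  then show "int N dvd j" by simp
qed auto

text \<open>Orthogonality of characters: a geometric sum whose ratio is an \<open>N\<close>-th root
  of unity vanishes unless the ratio is 1.\<close>

lemma sum_zeta:
  assumes "N > 0"
  shows "(\<Sum>d<N. zeta N (j * int d)) = (if int N dvd j then of_nat N else 0)"
proof (cases "int N dvd j")
  case True
  then show ?thesis
    using assms zeta_eq_1_iff[of N j] by (simp add: zeta_power)
next
  case False
  have "zeta N j ^ N = 1"
    using zeta_power[of N j N] zeta_multiple[of N j] by (simp add: mult.commute)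
  then have "(\<Sum>d<N. zeta N j ^ d) = 0"
    using sum_gp_strict[of "zeta N j" N] zeta_eq_1_iff[of N j] False assms by simp
  then show ?thesis using False by (simp add: zeta_power)
qed

lemma wrap_mod [simp]: "wrap N f (i mod int N) = wrap N f i"
  by (simp add: wrap_def)

lemma wrap_of_nat [simp]: "k < N \<Longrightarrow> wrap N f (int k) = f k"
  by (simp add: wrap_def)

text \<open>Exactly one \<open>k < N\<close> is congruent to \<open>- j\<close> modulo
  \<open>N\<close>.\<close>

lemma sum_dvd_add_eq_wrap:
  fixes B :: "nat \<Rightarrow> 'b::comm_monoid_add"
  assumes "N > 0"
  shows "(\<Sum>k<N. if int N dvd j + int k then B k else 0) = wrap N B (- j)"
proof -
  have "(int N dvd j + int k) \<longleftrightarrow> k = nat ((- j) mod int N)" if "k < N" for k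
  proof -
    have "(int N dvd j + int k) \<longleftrightarrow> int k mod int N = (- j) mod int N"
      by (subst mod_eq_dvd_iff) (simp add: add.commute)
    also have "\<dots> \<longleftrightarrow> int k = (- j) mod int N"
      using that by simp
    also have "\<dots> \<longleftrightarrow> k = nat ((- j) mod int N)"
      using assms by auto
    finally show ?thesis .
  qed
  then have "(\<Sum>k<N. if int N dvd j + int k then B k else 0)
      = (\<Sum>k<N. if k = nat ((- j) mod int N) then B k else 0)"
    by (intro sum.cong) auto
  also have "\<dots> = wrap N B (- j)"
    using assms by (simp add: wrap_def nat_less_iff)
  finally show ?thesis .
qed

text \<open>Orthogonality over \<open>d\<close> keeps only the pairs with \<open>k'\<close>
  congruent to \<open>- \<phi> k\<close>. The frequency map \<open>\<phi>\<close> is left free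
  because two choices are needed: \<open>- k\<close> for the energy and \<open>k + N/2\<close> for
  the alternating sum.\<close>

lemma parseval_zeta:
  assumes "N > 0"
  shows "(\<Sum>d<N. (\<Sum>k<N. A k * zeta N (\<phi> k * int d)) * (\<Sum>k<N. B k * zeta N (int k * int d)))
    = of_nat N * (\<Sum>k<N. A k * wrap N B (- \<phi> k))"
proof -
  have "(\<Sum>d<N. (\<Sum>k<N. A k * zeta N (\<phi> k * int d)) * (\<Sum>k<N. B k * zeta N (int k * int d)))
      = (\<Sum>d<N. \<Sum>k<N. \<Sum>k'<N. A k * (B k' * zeta N ((\<phi> k + int k') * int d)))"
    by (simp add: sum_product zeta_add ring_distribs mult_ac)
  also have "\<dots> = (\<Sum>k<N. \<Sum>d<N. \<Sum>k'<N. A k * (B k' * zeta N ((\<phi> k + int k') * int d)))"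
    by (rule sum.swap)
  also have "\<dots> = (\<Sum>k<N. \<Sum>k'<N. \<Sum>d<N. A k * (B k' * zeta N ((\<phi> k + int k') * int d)))"
    by (intro sum.cong refl sum.swap)
  also have "\<dots> = (\<Sum>k<N. A k * (of_nat N * (\<Sum>k'<N. if int N dvd \<phi> k + int k' then B k' else 0)))"
    unfolding sum_distrib_left[symmetric] sum_zeta[OF assms]
    by (simp add: sum_distrib_left if_distrib mult_ac cong: if_cong)
  also have "\<dots> = of_nat N * (\<Sum>k<N. A k * wrap N B (- \<phi> k))"
    by (simp add: sum_dvd_add_eq_wrap[OF assms] sum_distrib_left mult_ac)
  finally show ?thesis .
qed

section \<open>Second moments of independent families\<close>

lemma (in prob_space) indep_vars_mult_integral:
  fixes f g :: "'b \<Rightarrow> real"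
  assumes indep: "indep_vars S X I" and ij: "i \<in> I" "j \<in> I" "i \<noteq> j"
    and meas: "f \<in> borel_measurable (S i)" "g \<in> borel_measurable (S j)"
    and int: "has_bochner_integral M (\<lambda>\<omega>. f (X i \<omega>)) \<mu>"
      "has_bochner_integral M (\<lambda>\<omega>. g (X j \<omega>)) \<nu>"
  shows "has_bochner_integral M (\<lambda>\<omega>. f (X i \<omega>) * g (X j \<omega>)) (\<mu> * \<nu>)"
proof -
  \<comment> \<open>Composition with an independent family takes one function per index, so
    \<open>f\<close> and \<open>g\<close> are glued together.\<close>
  define F where "F k = (if k = i then f else g)" for k
  have "indep_vars S X {i, j}"
    using indep by (rule indep_vars_subset) (use ij in auto)
  then have "indep_vars (\<lambda>_. borel) (\<lambda>k \<omega>. F k (X k \<omega>)) {i, j}"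
    by (rule indep_vars_compose2) (use meas in \<open>auto simp: F_def\<close>)
  then have "integrable M (\<lambda>\<omega>. \<Prod>k\<in>{i, j}. F k (X k \<omega>))"
    "(\<integral>\<omega>. (\<Prod>k\<in>{i, j}. F k (X k \<omega>)) \<partial>M) = (\<Prod>k\<in>{i, j}. \<integral>\<omega>. F k (X k \<omega>) \<partial>M)"
    by (intro indep_vars_integrable indep_vars_lebesgue_integral;
        use int in \<open>auto simp: F_def has_bochner_integral_iff\<close>)+
  with ij int show ?thesis
    by (auto simp: F_def has_bochner_integral_iff)
qed

text \<open>In the expanded square only the diagonal survives. Phrased through second moments, this
  serves the data and the noise components alike.\<close>

lemma has_bochner_integral_square_sum_uncorrelated:
  fixes X :: "'i \<Rightarrow> 'a \<Rightarrow> real"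
  assumes "finite I"
    and X: "\<And>i j. i \<in> I \<Longrightarrow> j \<in> I \<Longrightarrow>
      has_bochner_integral M (\<lambda>\<omega>. X i \<omega> * X j \<omega>) (if i = j then v else 0)"
  shows "has_bochner_integral M (\<lambda>\<omega>. (\<Sum>i\<in>I. c i * X i \<omega>)\<^sup>2) (v * (\<Sum>i\<in>I. (c i)\<^sup>2))"
proof -
  have "has_bochner_integral M (\<lambda>\<omega>. \<Sum>i\<in>I. \<Sum>j\<in>I. (c i * c j) * (X i \<omega> * X j \<omega>))
      (\<Sum>i\<in>I. \<Sum>j\<in>I. (c i * c j) * (if i = j then v else 0))"
    by (intro has_bochner_integral_sum has_bochner_integral_mult_right X)
  also have "(\<Sum>i\<in>I. \<Sum>j\<in>I. (c i * c j) * (if i = j then v else 0)) = v * (\<Sum>i\<in>I. (c i)\<^sup>2)"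
    using assms(1)
    by (simp add: if_distrib sum_distrib_left power2_eq_square mult_ac cong: if_cong)
  finally show ?thesis
    by (simp add: power2_eq_square sum_product mult_ac)
qed

section \<open>Fourier transforms and half-differences\<close>

lemma dft_zeta:
  "dft N x k = of_real (1 / sqrt (real N)) * (\<Sum>m<N. x m * zeta N (- (int k * int m)))"
  by (simp add: dft_def zeta_def cis_conv_exp mult_ac)

lemma idft_zeta:
  "idft N Y m = of_real (1 / sqrt (real N)) * (\<Sum>k<N. Y k * zeta N (int k * int m))"
  by (simp add: idft_def zeta_def cis_conv_exp mult_ac)

lemma idft_add: "idft N (\<lambda>k. X k + Y k) m = idft N X m + idft N Y m"
  by (simp add: idft_def ring_distribs sum.distrib)

text \<open>The kernel is itself \<open>N\<close>-periodic in time. This absorbs the wrap in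
  \<open>combine\<close> at \<open>2 * l + 2 = N\<close>, which happens at the last symbol.\<close>

lemma wrap_idft:
  assumes "N > 0"
  shows "wrap N (idft N Y) (int m) = idft N Y m"
proof -
  have "zeta N (int k * int (m mod N)) = zeta N (int k * int m)" for k
    by (rule zeta_cong) (simp add: zmod_int mod_simps)
  then show ?thesis
    by (simp add: wrap_def idft_zeta flip: zmod_int)
qed

lemma one_minus_zeta_mult:
  "(1 - zeta N (int k)) * (1 - zeta N (- int k)) = of_real (2 * hann N k)"
proof -
  have "zeta N (int k) * zeta N (- int k) = 1"
    by (simp flip: zeta_add)
  then have "(1 - zeta N (int k)) * (1 - zeta N (- int k)) = 2 - (zeta N (int k) + zeta N (- int k))"
    by (simp add: algebra_simps)
  also have "\<dots> = of_real (2 * hann N k)"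
    by (simp add: complex_eq_iff zeta_def hann_def)
  finally show ?thesis .
qed

text \<open>Formed from the spectrum, so that the two parts of \<open>combine\<close> become values
  of one function at the consecutive times \<open>2 * l\<close> and
  \<open>2 * l + 1\<close>.\<close>

definition half_difference :: "nat \<Rightarrow> (nat \<Rightarrow> complex) \<Rightarrow> nat \<Rightarrow> complex" where
  "half_difference N Y m = (idft N Y m - idft N Y (m + 1)) / 2"

lemma combine_idft:
  assumes "N > 0"
  shows "combine N (idft N Y) l =
    of_real (Re (half_difference N Y (2 * l))) + \<i> * of_real (Im (half_difference N Y (2 * l + 1)))"
  by (simp only: combine_def wrap_idft[OF assms] half_difference_def) simp

lemma half_difference_zeta:
  "half_difference N Y m =
    (\<Sum>k<N. of_real (1 / (2 * sqrt (real N))) * (1 - zeta N (int k)) * zeta N (int k * int m) * Y k)"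
proof -
  have "zeta N (int k * int (m + 1)) = zeta N (int k * int m) * zeta N (int k)" for k
    by (simp add: algebra_simps flip: zeta_add)
  then show ?thesis
    unfolding half_difference_def idft_zeta right_diff_distrib[symmetric] sum_subtractf[symmetric]
      sum_distrib_left sum_divide_distrib
    by (intro sum.cong refl) (simp add: field_simps)
qed

section \<open>The RO-QPSK signal as a difference and its circular convolution\<close>

definition offset_symbol :: "(nat \<Rightarrow> real) \<Rightarrow> nat \<Rightarrow> complex" where
  "offset_symbol a n = (if even n then 1 else \<i>) * of_real (a n)"

lemma ro_qpsk_eq_difference:
  assumes "even N" "m < N"
  shows "ro_qpsk N a m = offset_symbol a m - wrap N (offset_symbol a) (int m - 1)"
proof (cases "m = 0")
  case True
  \<comment> \<open>Evenness of \<open>N\<close> makes the cyclic predecessor of 0 odd, so it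
    carries the factor \<open>\<i>\<close> that the even-index rule of \<open>ro_qpsk\<close>
    demands.\<close>
  have "nat ((-1) mod int N) = N - 1" "odd (N - 1)"
    using assms by (auto simp: zmod_minus1)
  then show ?thesis
    using assms True by (simp add: ro_qpsk_def offset_symbol_def wrap_def)
next
  case False
  then have "int m - 1 = int (m - 1)" by simp
  then show ?thesis
    using assms False by (simp add: ro_qpsk_def offset_symbol_def del: of_nat_diff)
qed

lemma dft_ro_qpsk:
  assumes "N > 0" "even N"
  shows "dft N (ro_qpsk N a) k = of_real (1 / sqrt (real N)) * (1 - zeta N (- int k)) *
    (\<Sum>n<N. offset_symbol a n * zeta N (- (int k * int n)))"
proof -
  let ?u = "offset_symbol a"
  \<comment> \<open>With exponent \<open>i + 1\<close>, the value \<open>F (m - 1)\<close> is the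
    delayed term \<open>u[m - 1]\<close> times the kernel at \<open>m\<close>; undoing the delay
    leaves the factor \<open>zeta N (- k)\<close>.\<close>
  define F where "F i = wrap N ?u i * zeta N (- (int k * (i + 1)))" for i
  have F: "F (i mod int N) = F i" for i
    unfolding F_def wrap_mod
    by (intro arg_cong2[where f = "(*)"] refl zeta_cong mod_minus_cong mod_mult_cong)
      (simp add: mod_simps)
  have "(\<Sum>m<N. ro_qpsk N a m * zeta N (- (int k * int m)))
      = (\<Sum>m<N. ?u m * zeta N (- (int k * int m))) - (\<Sum>m<N. F (int m + - 1))"
    unfolding sum_subtractf[symmetric]
    by (intro sum.cong refl) (simp add: ro_qpsk_eq_difference[OF assms(2)] F_def algebra_simps)
  also have "(\<Sum>m<N. F (int m + - 1)) = (\<Sum>m<N. F (int m))"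
    by (rule sum_periodic_shift) (use assms(1) F in auto)
  also have "\<dots> = zeta N (- int k) * (\<Sum>m<N. ?u m * zeta N (- (int k * int m)))"
    unfolding sum_distrib_left
    by (intro sum.cong refl) (simp add: F_def algebra_simps flip: zeta_add)
  finally show ?thesis
    by (simp only: dft_zeta left_diff_distrib right_diff_distrib mult.assoc mult_1_left mult_1_right)
qed

text \<open>The impulse response \<open>h\<close> at integer time offsets, which may be
  negative.\<close>

definition hann_response :: "nat \<Rightarrow> (nat \<Rightarrow> real) \<Rightarrow> int \<Rightarrow> complex" where
  "hann_response N G d = (1 / of_nat N) * (\<Sum>k<N. of_real (hann N k * G k) * zeta N (int k * d))"

lemma hann_response_0: "hann_response N G 0 = of_real (hann_mean N G)"
  by (simp add: hann_response_def hann_mean_def)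

lemma hann_response_mod: "hann_response N G (d mod int N) = hann_response N G d"
proof -
  have "zeta N (int k * (d mod int N)) = zeta N (int k * d)" for k
    by (rule zeta_cong) (simp add: mod_simps)
  then show ?thesis by (simp add: hann_response_def)
qed

lemma half_difference_ro_qpsk:
  assumes "N > 0" "even N"
  shows "half_difference N (\<lambda>k. of_real (G k) * dft N (ro_qpsk N a) k) m =
    (\<Sum>n<N. offset_symbol a n * hann_response N G (int m - int n))"
proof -
  let ?u = "offset_symbol a"
  have "half_difference N (\<lambda>k. of_real (G k) * dft N (ro_qpsk N a) k) m
      = (\<Sum>k<N. \<Sum>n<N. ?u n * (1 / of_nat N) * (of_real (hann N k * G k) * zeta N (int k * (int m - int n))))"
    unfolding half_difference_zeta dft_ro_qpsk[OF assms]
  proof (rule sum.cong)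
    fix k
    \<comment> \<open>The \<open>1/2\<close> left here cancels the 2 in
      \<open>one_minus_zeta_mult\<close>, giving the normalisation \<open>1/N\<close> of
      \<open>h\<close>.\<close>
    have s: "complex_of_real (1 / (2 * sqrt (real N))) * of_real (1 / sqrt (real N)) = 1 / (2 * of_nat N)"
      by (simp add: mult.assoc flip: of_real_mult) simp
    \<comment> \<open>\<open>S\<close> stands for the sum over \<open>n\<close>, kept opaque while
      the scalar factors are regrouped.\<close>
    have "of_real (1 / (2 * sqrt (real N))) * (1 - zeta N (int k)) * zeta N (int k * int m) *
        (of_real (G k) * (of_real (1 / sqrt (real N)) * (1 - zeta N (- int k)) * S))
      = (of_real (1 / (2 * sqrt (real N))) * of_real (1 / sqrt (real N))) *
        ((1 - zeta N (int k)) * (1 - zeta N (- int k))) * of_real (G k) * zeta N (int k * int m) * S" for S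
      by (simp only: mult_ac)
    also have "\<dots> S = 1 / of_nat N * of_real (hann N k * G k) * zeta N (int k * int m) * S" for S
      unfolding s one_minus_zeta_mult by simp
    finally have *: "of_real (1 / (2 * sqrt (real N))) * (1 - zeta N (int k)) * zeta N (int k * int m) *
        (of_real (G k) * (of_real (1 / sqrt (real N)) * (1 - zeta N (- int k)) * S))
      = 1 / of_nat N * of_real (hann N k * G k) * zeta N (int k * int m) * S" for S .
    have "zeta N (int k * (int m - int n)) = zeta N (int k * int m) * zeta N (- (int k * int n))" for n
      by (simp add: right_diff_distrib flip: zeta_add)
    then show "of_real (1 / (2 * sqrt (real N))) * (1 - zeta N (int k)) * zeta N (int k * int m) *
        (of_real (G k) * (of_real (1 / sqrt (real N)) * (1 - zeta N (- int k)) *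
          (\<Sum>n<N. ?u n * zeta N (- (int k * int n)))))
      = (\<Sum>n<N. ?u n * (1 / of_nat N) * (of_real (hann N k * G k) * zeta N (int k * (int m - int n))))"
      unfolding * by (simp add: sum_distrib_left sum_divide_distrib mult_ac)
  qed simp
  also have "\<dots> = (\<Sum>n<N. ?u n * hann_response N G (int m - int n))"
    by (subst sum.swap) (simp add: hann_response_def sum_distrib_left mult_ac)
  finally show ?thesis .
qed

section \<open>Normalisation of the Hann weights and the weighted variance\<close>

text \<open>The cosines are real parts of all \<open>N\<close>-th roots of unity, whose sum is zero
  once \<open>N > 1\<close>. For \<open>N = 1\<close> the only weight is 0.\<close>

lemma sum_hann:
  assumes "N > 1"
  shows "(\<Sum>k<N. hann N k) = real N"
proof -
  have "(\<Sum>k<N. zeta N (1 * int k)) = 0"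
    using assms by (subst sum_zeta) auto
  from arg_cong[OF this, of Re] have "(\<Sum>k<N. cos (2 * pi * real k / real N)) = 0"
    by (simp add: zeta_def)
  then show ?thesis
    by (simp add: hann_def sum_subtractf)
qed

text \<open>Mean square minus squared mean is the variance because, by \<open>sum_hann\<close>, the
  weights divided by \<open>N\<close> sum to 1.\<close>

lemma sigma_sq_eq_variance:
  assumes "N > 1"
  shows "sigma_sq N G = (1 / real N) * (\<Sum>k<N. hann N k * (G k - hann_mean N G)\<^sup>2)"
proof -
  let ?m = "hann_mean N G"
  have m: "(\<Sum>k<N. hann N k * G k) = real N * ?m"
    using assms by (simp add: hann_mean_def)
  have "(\<Sum>k<N. hann N k * (G k - ?m)\<^sup>2)
      = (\<Sum>k<N. hann N k * (G k)\<^sup>2 - 2 * ?m * (hann N k * G k) + ?m\<^sup>2 * hann N k)"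
    by (intro sum.cong refl) (simp add: power2_eq_square algebra_simps)
  also have "\<dots> = (\<Sum>k<N. hann N k * (G k)\<^sup>2) - real N * ?m\<^sup>2"
    by (simp add: sum.distrib sum_subtractf m sum_hann[OF assms] power2_eq_square
        flip: sum_distrib_left)
  finally show ?thesis
    using assms by (simp add: sigma_sq_def right_diff_distrib)
qed

section \<open>Energy of the response seen by one quadrature\<close>

lemma hann_eq_zeta: "hann N k = 1 - Re (zeta N (int k))"
  by (simp add: hann_def zeta_def)

lemma zeta_half: "N > 0 \<Longrightarrow> even N \<Longrightarrow> zeta N (int (N div 2)) = -1"
  by (auto elim!: evenE simp: zeta_def)

text \<open>Since \<open>zeta N (N div 2) = -1\<close>, the reflection negates the cosine, turning
  \<open>1 - cos\<close> into \<open>1 + cos\<close>.\<close>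

lemma wrap_reflect_hann:
  assumes "N > 0" "even N"
  shows "wrap N (\<lambda>k. hann N k * G k) (int (N div 2) - int k)
    = (2 - hann N k) * wrap N G (int (N div 2) - int k)"
proof -
  let ?j = "int (N div 2) - int k"
  have "zeta N (int (nat (?j mod int N))) = zeta N ?j"
    using assms by (intro zeta_cong) simp
  moreover have "zeta N ?j = - zeta N (- int k)"
    using zeta_add[of N "int (N div 2)" "- int k"] zeta_half[OF assms] by simp
  ultimately have "Re (zeta N (int (nat (?j mod int N)))) = - Re (zeta N (int k))"
    by (simp add: cnj_zeta[symmetric] del: int_nat_eq)
  then have "hann N (nat (?j mod int N)) = 2 - hann N k"
    by (simp only: hann_eq_zeta)
  then show ?thesis by (simp add: wrap_def)
qed

text \<open>Even offsets couple equal quadratures through \<open>Re h\<close>, odd offsets couple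
  opposite ones through \<open>Im h\<close>.\<close>

definition quadrature_energy :: "nat \<Rightarrow> (nat \<Rightarrow> real) \<Rightarrow> int \<Rightarrow> real" where
  "quadrature_energy N G d =
    (if even d then (Re (hann_response N G d))\<^sup>2 else (Im (hann_response N G d))\<^sup>2)"

lemma sum_quadrature_energy:
  assumes "N > 0" "even N"
  shows "(\<Sum>d<N. quadrature_energy N G (int d)) = nu N G"
proof -
  define A :: "nat \<Rightarrow> complex" where "A k = of_real (hann N k * G k)" for k
  define h where "h d = (\<Sum>k<N. A k * zeta N (int k * int d))" for d :: nat
  have h: "hann_response N G (int d) = h d / of_nat N" for d
    by (simp add: hann_response_def h_def A_def)
  have "cnj (h d) = (\<Sum>k<N. A k * zeta N (- int k * int d))" for d
    by (simp add: h_def A_def cnj_zeta)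
  then have norm: "(\<Sum>d<N. cnj (h d) * h d) = of_nat N * (\<Sum>k<N. A k * A k)"
    using parseval_zeta[OF assms(1), of A "\<lambda>k. - int k" A] by (simp add: h_def)
  have wrap_A: "wrap N A (- (int k + int (N div 2)))
      = of_real ((2 - hann N k) * wrap N G (int (N div 2) - int k))" for k
  proof -
    \<comment> \<open>The index delivered by Parseval and the reflected index in \<open>nu\<close>
      differ by exactly one period.\<close>
    have "- (int k + int (N div 2)) = (int (N div 2) - int k) - int N"
      using assms(2) by (auto elim!: evenE)
    then have "wrap N A (- (int k + int (N div 2))) = wrap N A (int (N div 2) - int k - int N)"
      by (simp only:)
    also have "\<dots> = wrap N A (int (N div 2) - int k)"
      by (simp add: wrap_def)
    also have "\<dots> = of_real (wrap N (\<lambda>k. hann N k * G k) (int (N div 2) - int k))"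
      by (simp add: wrap_def A_def)
    finally show ?thesis by (simp only: wrap_reflect_hann[OF assms])
  qed
  \<comment> \<open>The alternating sign is a power of \<open>zeta N (N div 2)\<close>, that is, a
    frequency shift by \<open>N/2\<close>.\<close>
  have "(-1) ^ d * h d = (\<Sum>k<N. A k * zeta N ((int k + int (N div 2)) * int d))" for d
    unfolding h_def sum_distrib_left zeta_half[OF assms, symmetric] zeta_power[symmetric]
    by (simp add: ring_distribs zeta_add mult_ac)
  then have alt: "(\<Sum>d<N. (-1) ^ d * h d * h d) = of_nat N *
      (\<Sum>k<N. A k * of_real ((2 - hann N k) * wrap N G (int (N div 2) - int k)))"
    using parseval_zeta[OF assms(1), of A "\<lambda>k. int k + int (N div 2)" A]
    by (simp only: h_def wrap_A)
  \<comment> \<open>Both parities at once: the sign selects \<open>|h|^2 + Re (h^2)\<close> or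
    \<open>|h|^2 - Re (h^2)\<close>. Here \<open>h\<close> lacks the factor \<open>1/N\<close>,
    hence the square of \<open>N\<close> in the denominator.\<close>
  have "quadrature_energy N G (int d)
      = Re (cnj (h d) * h d + (-1) ^ d * h d * h d) / (2 * (real N)\<^sup>2)" for d
    using assms(1)
    by (cases "even d") (simp_all add: quadrature_energy_def h power_divide field_simps power2_eq_square)
  then have "(\<Sum>d<N. quadrature_energy N G (int d))
      = Re ((\<Sum>d<N. cnj (h d) * h d) + (\<Sum>d<N. (-1) ^ d * h d * h d)) / (2 * (real N)\<^sup>2)"
    by (simp only: sum_divide_distrib[symmetric] Re_sum[symmetric] sum.distrib)
  also have "\<dots> = nu N G"
    unfolding norm alt nu_def nu_with_def
    using assms(1) by (simp add: A_def sum.distrib ring_distribs add_divide_distrib power2_eq_square mult_ac)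
  finally show ?thesis .
qed

section \<open>The interference as a linear form in the data\<close>

lemma combine_add: "combine N (\<lambda>m. r m + s m) l = combine N r l + combine N s l"
  by (simp add: combine_def wrap_def complex_eq_iff add_divide_distrib diff_divide_distrib)

text \<open>The coefficient of \<open>\<alpha>\<^sub>n\<close> in the real part (\<open>m\<close> even) or imaginary part (\<open>m\<close> odd) of the
  half-difference at \<open>m\<close>; odd \<open>n\<close> carry a factor \<open>\<i>\<close>, whence the sign.\<close>

definition tap :: "nat \<Rightarrow> (nat \<Rightarrow> real) \<Rightarrow> nat \<Rightarrow> nat \<Rightarrow> real" where
  "tap N G m n = (let h = hann_response N G (int m - int n) in
     if even m \<longleftrightarrow> even n then Re h else if even m then - Im h else Im h)"

lemma tap_square: "(tap N G m n)\<^sup>2 = quadrature_energy N G (int m - int n)"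
  by (auto simp: tap_def quadrature_energy_def)

lemma tap_self: "tap N G m m = hann_mean N G"
  by (simp add: tap_def hann_response_0)

text \<open>Deleting the useful tap removes the squared Hann mean from the total energy
  \<open>nu\<close>.\<close>

lemma sum_tap_square:
  assumes "N > 0" "even N" "m < N"
  shows "(\<Sum>n<N. (tap N G m n - (if n = m then hann_mean N G else 0))\<^sup>2) = rho_sq N G"
proof -
  \<comment> \<open>Parity of the offset survives reduction modulo \<open>N\<close> because
    \<open>N\<close> is even.\<close>
  have mod: "quadrature_energy N G (i mod int N) = quadrature_energy N G i" for i
    using assms(2) by (simp add: quadrature_energy_def hann_response_mod dvd_mod_iff)
  have "(\<Sum>n<N. (tap N G m n - (if n = m then hann_mean N G else 0))\<^sup>2)
      = (\<Sum>n<N. (tap N G m n)\<^sup>2 - (if n = m then (hann_mean N G)\<^sup>2 else 0))"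
    by (intro sum.cong refl) (auto simp: tap_self)
  also have "\<dots> = (\<Sum>n<N. quadrature_energy N G (int m - int n)) - (hann_mean N G)\<^sup>2"
    using assms(3) by (simp add: sum_subtractf tap_square)
  also have "\<dots> = rho_sq N G"
    by (simp only: sum_periodic_reflect[where F = "quadrature_energy N G", OF assms(1) mod]
        sum_quadrature_energy[OF assms(1,2)] rho_sq_def)
  finally show ?thesis .
qed

text \<open>By linearity the noise cancels, and subtracting the scaled QPSK symbol removes from each
  quadrature precisely the tap at its own index.\<close>

lemma interference_eq:
  assumes "N > 0" "even N" "l < N div 2"
    and real: "\<And>k. k < N \<Longrightarrow> E k * H k \<in> \<real>"
  shows "interference N H E a z l =
    of_real (\<Sum>n<N. (tap N (gain H E) (2 * l) n
        - (if n = 2 * l then hann_mean N (gain H E) else 0)) * a n) +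
    \<i> * of_real (\<Sum>n<N. (tap N (gain H E) (2 * l + 1) n
        - (if n = 2 * l + 1 then hann_mean N (gain H E) else 0)) * a n)"
proof -
  let ?G = "gain H E"
  let ?S = "\<lambda>k. of_real (?G k) * dft N (ro_qpsk N a) k"
  have GE: "of_real (?G k) = E k * H k" if "k < N" for k
    unfolding gain_def using real[OF that] by (rule of_real_Re)
  \<comment> \<open>The gains equal \<open>E k * H k\<close> only for \<open>k < N\<close>, so the
    comparison is made under the sum in \<open>idft\<close>.\<close>
  have "despread N H E a z = (\<lambda>m. idft N ?S m + despread_noise N E z m)"
    unfolding despread_def despread_noise_def idft_add[symmetric] received_def
    by (intro ext, unfold idft_def, intro arg_cong2[where f = "(*)"] refl sum.cong)
       (simp add: GE algebra_simps)
  then have "interference N H E a z l = combine N (idft N ?S) l - of_real (hann_mean N ?G) * qpsk a l"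
    by (simp add: interference_def combine_add)
  moreover have "Re (half_difference N ?S m) = (\<Sum>n<N. tap N ?G m n * a n)" if "even m" for m
    using that unfolding half_difference_ro_qpsk[OF assms(1,2)] Re_sum
    by (intro sum.cong refl) (auto simp: offset_symbol_def tap_def)
  moreover have "Im (half_difference N ?S m) = (\<Sum>n<N. tap N ?G m n * a n)" if "odd m" for m
    using that unfolding half_difference_ro_qpsk[OF assms(1,2)] Im_sum
    by (intro sum.cong refl) (auto simp: offset_symbol_def tap_def)
  moreover have "2 * l < N" "2 * l + 1 < N" using assms(2,3) by auto
  ultimately show ?thesis
    by (simp add: combine_idft[OF assms(1)] qpsk_def left_diff_distrib sum_subtractf
        if_distrib[of "\<lambda>x. x * _"] complex_eq_iff cong: if_cong)
qed

section \<open>Noise power\<close>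

lemma cmod_square_of_reals: "(cmod (of_real x + \<i> * of_real y))\<^sup>2 = x\<^sup>2 + y\<^sup>2"
  by (simp add: cmod_power2)

lemma cmod_one_minus_zeta: "(cmod (1 - zeta N (int k)))\<^sup>2 = 2 * hann N k"
proof -
  have "of_real ((cmod (1 - zeta N (int k)))\<^sup>2) = complex_of_real (2 * hann N k)"
    unfolding complex_norm_square one_minus_zeta_mult[symmetric] by (simp add: cnj_zeta)
  then show ?thesis by (simp only: of_real_eq_iff)
qed

text \<open>Combining takes real and imaginary parts, so componentwise moments are required: each
  part carries half the power, and independence with zero means kills the mixed moment.\<close>

lemma circ_gaussian_real_moments:
  assumes "prob_space M" "v > 0" "circ_gaussian M v Z"
  shows "has_bochner_integral M (\<lambda>\<omega>. Re (Z \<omega>)) 0" "has_bochner_integral M (\<lambda>\<omega>. Im (Z \<omega>)) 0"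
    "has_bochner_integral M (\<lambda>\<omega>. Re (Z \<omega>) * Re (Z \<omega>)) (v / 2)"
    "has_bochner_integral M (\<lambda>\<omega>. Im (Z \<omega>) * Im (Z \<omega>)) (v / 2)"
    "has_bochner_integral M (\<lambda>\<omega>. Re (Z \<omega>) * Im (Z \<omega>)) 0"
proof -
  interpret prob_space M by fact
  have s: "sqrt (v / 2) > 0" using assms(2) by simp
  have moments: "has_bochner_integral M X 0 \<and> has_bochner_integral M (\<lambda>\<omega>. X \<omega> * X \<omega>) (v / 2)"
    if d: "distributed M lborel X (normal_density 0 (sqrt (v / 2)))" for X :: "'a \<Rightarrow> real"
  proof -
    have "integrable M X"
      using integrable_normal_moment[OF s, of 0 1] distributed_integrable[OF d, of "\<lambda>x. x"] by simp
    moreover have "integrable M (\<lambda>\<omega>. (X \<omega>)\<^sup>2)"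
      using integrable_normal_moment[OF s, of 0 2] distributed_integrable[OF d, of "\<lambda>x. x\<^sup>2"] by simp
    ultimately show ?thesis
      using normal_distributed_variance[OF s d] normal_distributed_expectation[OF s d] assms(2)
      by (simp add: has_bochner_integral_iff power2_eq_square)
  qed
  show Re: "has_bochner_integral M (\<lambda>\<omega>. Re (Z \<omega>)) 0" and Im: "has_bochner_integral M (\<lambda>\<omega>. Im (Z \<omega>)) 0"
    and "has_bochner_integral M (\<lambda>\<omega>. Re (Z \<omega>) * Re (Z \<omega>)) (v / 2)"
    "has_bochner_integral M (\<lambda>\<omega>. Im (Z \<omega>) * Im (Z \<omega>)) (v / 2)"
    using moments assms(3) by (auto simp: circ_gaussian_def)
  have "indep_var borel (\<lambda>\<omega>. Re (Z \<omega>)) borel (\<lambda>\<omega>. Im (Z \<omega>))"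
    using assms(3) by (simp add: circ_gaussian_def)
  from indep_var_lebesgue_integral[OF this] indep_var_integrable[OF this]
  show "has_bochner_integral M (\<lambda>\<omega>. Re (Z \<omega>) * Im (Z \<omega>)) 0"
    using Re Im by (simp add: has_bochner_integral_iff)
qed

text \<open>Both parts of the sum are real combinations of uncorrelated variables of variance
  \<open>v / 2\<close>. For each \<open>k\<close> the coefficients are, up to sign and order,
  \<open>Re (c k)\<close> and \<open>Im (c k)\<close>, with squares adding to
  \<open>|c k|^2\<close>.\<close>

lemma has_bochner_integral_Re_Im_square_sum:
  assumes "prob_space M" "finite I" "v > 0"
    and indep: "prob_space.indep_vars M (\<lambda>_. borel) Z I"
    and gauss: "\<And>k. k \<in> I \<Longrightarrow> circ_gaussian M v (Z k)"
  shows "has_bochner_integral M (\<lambda>\<omega>. (Re (\<Sum>k\<in>I. c k * Z k \<omega>))\<^sup>2) (v / 2 * (\<Sum>k\<in>I. (cmod (c k))\<^sup>2))"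
    and "has_bochner_integral M (\<lambda>\<omega>. (Im (\<Sum>k\<in>I. c k * Z k \<omega>))\<^sup>2) (v / 2 * (\<Sum>k\<in>I. (cmod (c k))\<^sup>2))"
proof -
  interpret prob_space M by fact
  define part where "part r = (if r then Re else Im)" for r
  \<comment> \<open>A pair indexes one real component: \<open>True\<close> selects the real part and
    \<open>False\<close> the imaginary part.\<close>
  define X where "X p \<omega> = part (snd p) (Z (fst p) \<omega>)" for p :: "'b \<times> bool" and \<omega>
  note moments = circ_gaussian_real_moments[OF assms(1,3) gauss]
  have meas: "part r \<in> borel_measurable borel" for r
    by (cases r) (simp_all add: part_def)
  have mean: "has_bochner_integral M (\<lambda>\<omega>. part r (Z k \<omega>)) 0" if "k \<in> I" for r k
    using moments(1,2)[OF that] by (simp add: part_def)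
  have X: "has_bochner_integral M (\<lambda>\<omega>. X p \<omega> * X q \<omega>) (if p = q then v / 2 else 0)"
    if "p \<in> I \<times> UNIV" "q \<in> I \<times> UNIV" for p q
  proof (cases "fst p = fst q")
    case True
    with that show ?thesis
      using moments(3-5)[of "fst q"]
      by (cases p; cases q; cases "snd p"; cases "snd q") (auto simp: X_def part_def mult.commute)
  next
    case False
    with that have "has_bochner_integral M (\<lambda>\<omega>. X p \<omega> * X q \<omega>) (0 * 0)"
      unfolding X_def by (intro indep_vars_mult_integral[OF indep] meas mean) auto
    with False show ?thesis by auto
  qed
  have square: "has_bochner_integral M (\<lambda>\<omega>. (\<Sum>p\<in>I \<times> UNIV. a p * X p \<omega>)\<^sup>2)
      (v / 2 * (\<Sum>p\<in>I \<times> UNIV. (a p)\<^sup>2))" for a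
    by (rule has_bochner_integral_square_sum_uncorrelated) (use assms(2) X in auto)
  have split: "(\<Sum>p\<in>I \<times> UNIV. f p) = (\<Sum>k\<in>I. f (k, True) + f (k, False))" for f :: "'b \<times> bool \<Rightarrow> real"
    by (simp add: sum.cartesian_product[symmetric, where g = "\<lambda>k r. f (k, r)", simplified] UNIV_bool add.commute)
  show "has_bochner_integral M (\<lambda>\<omega>. (Re (\<Sum>k\<in>I. c k * Z k \<omega>))\<^sup>2) (v / 2 * (\<Sum>k\<in>I. (cmod (c k))\<^sup>2))"
    using square[of "\<lambda>p. if snd p then Re (c (fst p)) else - Im (c (fst p))"]
    by (simp add: split X_def part_def cmod_power2)
  show "has_bochner_integral M (\<lambda>\<omega>. (Im (\<Sum>k\<in>I. c k * Z k \<omega>))\<^sup>2) (v / 2 * (\<Sum>k\<in>I. (cmod (c k))\<^sup>2))"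
    using square[of "\<lambda>p. if snd p then Im (c (fst p)) else Re (c (fst p))"]
    by (simp add: split X_def part_def cmod_power2 add.commute)
qed

text \<open>The half-difference has power \<open>1/2\<close> times the Hann mean at every time. Each
  quadrature takes half of that, and the two contributions add.\<close>

lemma noise_power:
  assumes "prob_space M" "N > 0"
    and "prob_space.indep_vars M (\<lambda>_. borel) Z {..<N}"
    and "\<And>k. k < N \<Longrightarrow> circ_gaussian M 1 (Z k)"
  shows "has_bochner_integral M (\<lambda>\<omega>. (cmod (noise_rv N E Z l \<omega>))\<^sup>2)
    ((1 / 2) * hann_mean N (\<lambda>k. (cmod (E k))\<^sup>2))"
proof -
  define c where "c m k =
    of_real (1 / (2 * sqrt (real N))) * (1 - zeta N (int k)) * zeta N (int k * int m) * E k" for m k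
  have "(cmod (c m k))\<^sup>2 = hann N k * (cmod (E k))\<^sup>2 / (2 * real N)" for m k
    unfolding c_def norm_mult power_mult_distrib cmod_one_minus_zeta
    by (simp add: norm_divide power_divide power_mult_distrib)
  then have c: "(\<Sum>k<N. (cmod (c m k))\<^sup>2) = hann_mean N (\<lambda>k. (cmod (E k))\<^sup>2) / 2" for m
    by (simp add: hann_mean_def sum_divide_distrib[symmetric] field_simps)
  have "noise_rv N E Z l \<omega> = of_real (Re (\<Sum>k<N. c (2 * l) k * Z k \<omega>))
      + \<i> * of_real (Im (\<Sum>k<N. c (2 * l + 1) k * Z k \<omega>))" for \<omega>
    by (simp only: noise_rv_def despread_noise_def combine_idft[OF assms(2)] half_difference_zeta
        c_def mult.assoc)
  then have *: "(\<lambda>\<omega>. (cmod (noise_rv N E Z l \<omega>))\<^sup>2) = (\<lambda>\<omega>.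
      (Re (\<Sum>k<N. c (2 * l) k * Z k \<omega>))\<^sup>2 + (Im (\<Sum>k<N. c (2 * l + 1) k * Z k \<omega>))\<^sup>2)"
    by (simp only: cmod_square_of_reals)
  note int = has_bochner_integral_Re_Im_square_sum[OF assms(1) finite_lessThan _ assms(3)]
  have "has_bochner_integral M (\<lambda>\<omega>. (cmod (noise_rv N E Z l \<omega>))\<^sup>2)
      (1 / 2 * (\<Sum>k<N. (cmod (c (2 * l) k))\<^sup>2) + 1 / 2 * (\<Sum>k<N. (cmod (c (2 * l + 1) k))\<^sup>2))"
    unfolding * by (intro has_bochner_integral_add int) (use assms(4) in auto)
  then show ?thesis by (simp only: c) simp
qed

section \<open>Interference power\<close>

text \<open>\<open>pam\<close> has constant square \<open>1/2\<close>, which settles the diagonal;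
  off it, independence and zero means apply.\<close>

lemma component_uncorrelated:
  assumes "prob_space M"
    and indep: "prob_space.indep_vars M (\<lambda>_. count_space UNIV) b I"
    and fair: "\<And>m. m \<in> I \<Longrightarrow> distr M (count_space UNIV) (b m) = measure_pmf (bernoulli_pmf (1 / 2))"
    and ij: "i \<in> I" "j \<in> I"
  shows "has_bochner_integral M (\<lambda>\<omega>. component b \<omega> i * component b \<omega> j) (if i = j then 1 / 2 else 0)"
proof (cases "i = j")
  interpret prob_space M by fact
  case True
  have *: "component b \<omega> j * component b \<omega> j = 1 / 2" for \<omega>
    by (simp add: component_def pam_def)
  show ?thesis
    unfolding True * by (simp add: has_bochner_integral_iff prob_space)
next
  interpret prob_space M by fact
  case False
  have mean: "has_bochner_integral M (\<lambda>\<omega>. pam (b m \<omega>)) 0" if "m \<in> I" for m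
  proof -
    have b [measurable]: "b m \<in> measurable M (count_space UNIV)"
      using indep that by (simp add: indep_vars_def2)
    have "integrable M (\<lambda>\<omega>. pam (b m \<omega>))"
      by (rule integrable_const_bound[where B = 1]) (auto simp: pam_def)
    moreover have "(\<integral>\<omega>. pam (b m \<omega>) \<partial>M) = (\<integral>x. pam x \<partial>distr M (count_space UNIV) (b m))"
      by (simp add: integral_distr)
    ultimately show ?thesis
      by (simp add: fair[OF that] has_bochner_integral_iff pam_def)
  qed
  have "has_bochner_integral M (\<lambda>\<omega>. pam (b i \<omega>) * pam (b j \<omega>)) (0 * 0)"
    using ij False by (intro indep_vars_mult_integral[OF indep] mean) auto
  with False show ?thesis by (simp add: component_def)
qed

text \<open>The data variance \<open>1/2\<close> gives each quadrature \<open>rho_sq / 2\<close>,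
  because the tap energy is the same at times \<open>2 * l\<close> and
  \<open>2 * l + 1\<close>.\<close>

lemma interference_power:
  assumes "prob_space M" "N > 0" "even N" "l < N div 2"
    and "prob_space.indep_vars M (\<lambda>_. count_space UNIV) b {..<N}"
    and "\<And>m. m < N \<Longrightarrow> distr M (count_space UNIV) (b m) = measure_pmf (bernoulli_pmf (1 / 2))"
    and "\<And>k. k < N \<Longrightarrow> E k * H k \<in> \<real>"
  shows "has_bochner_integral M (\<lambda>\<omega>. (cmod (interf_rv N H E b Z l \<omega>))\<^sup>2) (rho_sq N (gain H E))"
proof -
  let ?G = "gain H E"
  let ?c = "\<lambda>m n. tap N ?G m n - (if n = m then hann_mean N ?G else 0)"
  have square: "has_bochner_integral M (\<lambda>\<omega>. (\<Sum>n<N. ?c m n * component b \<omega> n)\<^sup>2)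
      (1 / 2 * (\<Sum>n<N. (?c m n)\<^sup>2))" for m
    by (intro has_bochner_integral_square_sum_uncorrelated component_uncorrelated[OF assms(1,5)])
       (use assms(6) in auto)
  have eq: "interference N H E a z l = of_real (\<Sum>n<N. ?c (2 * l) n * a n)
      + \<i> * of_real (\<Sum>n<N. ?c (2 * l + 1) n * a n)" for a z
    by (rule interference_eq[OF assms(2-4,7)])
  have "has_bochner_integral M (\<lambda>\<omega>. (cmod (interf_rv N H E b Z l \<omega>))\<^sup>2)
      (1 / 2 * (\<Sum>n<N. (?c (2 * l) n)\<^sup>2) + 1 / 2 * (\<Sum>n<N. (?c (2 * l + 1) n)\<^sup>2))"
    unfolding interf_rv_def eq cmod_square_of_reals
    by (intro has_bochner_integral_add square)
  moreover have "2 * l < N" "2 * l + 1 < N" using assms(3,4) by auto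
  ultimately show ?thesis
    by (simp only: sum_tap_square[OF assms(2,3)]) simp
qed

section \<open>Assembly of the SINR and the approximation of \<open>nu\<close>\<close>

theorem proposition3:
  fixes M :: "'a measure" and N :: nat
    and H E :: "nat \<Rightarrow> complex"
    and b :: "nat \<Rightarrow> 'a \<Rightarrow> bool" and Z :: "nat \<Rightarrow> 'a \<Rightarrow> complex"
  assumes "prob_space M"
    and "N > 0" and "even N"
    and bits_indep: "prob_space.indep_vars M (\<lambda>_. count_space UNIV) b {..<N}"
    and bits_fair: "\<And>m. m < N \<Longrightarrow> distr M (count_space UNIV) (b m) = measure_pmf (bernoulli_pmf (1 / 2))"
    and noise_indep: "prob_space.indep_vars M (\<lambda>_. borel) Z {..<N}"
    and noise_gauss: "\<And>k. k < N \<Longrightarrow> circ_gaussian M 1 (Z k)"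
    and data_noise_indep: "indep_pair M
          (PiM {..<N} (\<lambda>_. count_space UNIV)) (\<lambda>\<omega>. \<lambda>m\<in>{..<N}. b m \<omega>)
          (PiM {..<N} (\<lambda>_. borel)) (\<lambda>\<omega>. \<lambda>k\<in>{..<N}. Z k \<omega>)"
    and gain_real: "\<And>k. k < N \<Longrightarrow> E k * H k \<in> \<real>"
  shows "(\<forall>l < N div 2.
            sinr M N H E b Z l =
              (hann_mean N (gain H E))\<^sup>2 /
                (rho_sq N (gain H E) + (1 / 2) * hann_mean N (\<lambda>k. (cmod (E k))\<^sup>2)) \<and>
            integrable M (\<lambda>\<omega>. (cmod (noise_rv N E Z l \<omega>))\<^sup>2) \<and>
            (\<integral>\<omega>. (cmod (noise_rv N E Z l \<omega>))\<^sup>2 \<partial>M) =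
              (1 / 2) * hann_mean N (\<lambda>k. (cmod (E k))\<^sup>2) \<and>
            integrable M (\<lambda>\<omega>. (cmod (interf_rv N H E b Z l \<omega>))\<^sup>2) \<and>
            (\<integral>\<omega>. (cmod (interf_rv N H E b Z l \<omega>))\<^sup>2 \<partial>M) = rho_sq N (gain H E)) \<and>
         nu_with N (gain H E) (gain H E) =
           (1 / real N) * (\<Sum>k<N. hann N k * (gain H E k)\<^sup>2) \<and>
         nu_with N (gain H E) (gain H E) - (hann_mean N (gain H E))\<^sup>2 = sigma_sq N (gain H E) \<and>
         sigma_sq N (gain H E) =
           (1 / real N) * (\<Sum>k<N. hann N k * (gain H E k - hann_mean N (gain H E))\<^sup>2)"
proof -
  have noise: "has_bochner_integral M (\<lambda>\<omega>. (cmod (noise_rv N E Z l \<omega>))\<^sup>2)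
      ((1 / 2) * hann_mean N (\<lambda>k. (cmod (E k))\<^sup>2))" for l
    by (rule noise_power) fact+
  have interf: "has_bochner_integral M (\<lambda>\<omega>. (cmod (interf_rv N H E b Z l \<omega>))\<^sup>2) (rho_sq N (gain H E))"
    if "l < N div 2" for l
    by (rule interference_power) fact+
  \<comment> \<open>With the reflected gain replaced by \<open>G k\<close>, the bracket collapses to
    \<open>2 * G k\<close>, which cancels the \<open>1/2\<close> in front.\<close>
  have nu: "nu_with N G G = (1 / real N) * (\<Sum>k<N. hann N k * (G k)\<^sup>2)" for G
  proof -
    have "(\<Sum>k<N. hann N k * G k * (hann N k * G k + (2 - hann N k) * G k))
        = 2 * (\<Sum>k<N. hann N k * (G k)\<^sup>2)"
      unfolding sum_distrib_left by (intro sum.cong refl) (simp add: algebra_simps power2_eq_square)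
    then show ?thesis by (simp add: nu_with_def)
  qed
  \<comment> \<open>Evenness excludes \<open>N = 1\<close>, where the weights would not be
    normalised.\<close>
  have "N > 1" using assms(2,3) by (cases "N = 1") auto
  show ?thesis
    using noise interf nu sigma_sq_eq_variance[OF \<open>N > 1\<close>, of "gain H E"]
    by (auto simp: has_bochner_integral_iff sinr_def sigma_sq_def)
qed

end
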